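(* Let $k$ be a positive integer and $n_1, \dots, n_k \geq 2$ integers. Then $B(\square^k_{i=1} P_{n_i}) \leq \left\lfloor \frac{5k}{2} \right\rfloor$.
   Context: $P_n$ is the path on $n$ vertices and $\square^k_{i=1} P_{n_i} = P_{n_1}\square\cdots\square P_{n_k}$ is the $k$-dimensional Cartesian grid, where the Cartesian product $G\square H$ has vertex set $V(G)\times V(H)$, with $(u,v)$ adjacent to $(x,y)$ iff either $ux\in E(G)$ and $v=y$, or $u=x$ and $vy\in E(H)$. Bodyguards and Presidents is a two-player game on a finite simple graph $G$. One player controls a set of tokens called bodyguards, the other a single token called the president. First all bodyguards are placed on vertices (several may share a vertex), then the president is placed. The players then alternate turns, bodyguards first; on a player's turn, each token they control either moves to an adjacent vertex or stays put. The president is surrounded if every vertex of the open neighbourhood of the president's vertex is occupied by a bodyguard. The bodyguards win if there is a finite time after which, at the end of every bodyguard turn, the president is surrounded; otherwise the president wins. The bodyguard number $B(G)$ is the minimum number of bodyguards that guarantees a win for the bodyguards on $G$. *)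

theory Defs
  imports Complex_Main "Graph_Theory.Pair_Digraph"
begin

text \<open>
  A finite simple graph is a \<^locale>\<open>pair_graph\<close>: an edge between \<open>u\<close> and \<open>v\<close> is represented by the
  two arcs \<open>(u, v)\<close> and \<open>(v, u)\<close>.
\<close>

definition path_graph :: "nat \<Rightarrow> nat pair_pre_digraph" where
  "path_graph n = \<lparr> pverts = {1..n},
     parcs = {(i, j). i \<in> {1..n} \<and> j \<in> {1..n} \<and> (j = Suc i \<or> i = Suc j)} \<rparr>"

definition cartesian_product ::
    "'a pair_pre_digraph \<Rightarrow> 'b pair_pre_digraph \<Rightarrow> ('a \<times> 'b) pair_pre_digraph" where
  "cartesian_product G H = \<lparr> pverts = pverts G \<times> pverts H,
     parcs = {((u, v), (x, y)). (u, v) \<in> pverts G \<times> pverts H \<and> (x, y) \<in> pverts G \<times> pverts H \<and>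
       ((u, x) \<in> parcs G \<and> v = y \<or> u = x \<and> (v, y) \<in> parcs H)} \<rparr>"

text \<open>
  Iterated Cartesian product. The vertex \<open>(x\<^sub>1, (x\<^sub>2, \<dots>))\<close> is relabelled as the list
  \<open>[x\<^sub>1, x\<^sub>2, \<dots>]\<close>, so that the vertex type does not depend on the number of factors. The empty
  product is the one-vertex graph.
\<close>

definition relabel :: "('a \<Rightarrow> 'b) \<Rightarrow> 'a pair_pre_digraph \<Rightarrow> 'b pair_pre_digraph" where
  "relabel f G = \<lparr> pverts = f ` pverts G, parcs = map_prod f f ` parcs G \<rparr>"

primrec cartesian_products :: "'a pair_pre_digraph list \<Rightarrow> 'a list pair_pre_digraph" where
  "cartesian_products [] = \<lparr> pverts = {[]}, parcs = {} \<rparr>"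
| "cartesian_products (G # Gs) =
     relabel (\<lambda>(x, xs). x # xs) (cartesian_product G (cartesian_products Gs))"

text \<open>The grid with side lengths \<open>n 1, \<dots>, n k\<close>.\<close>

definition grid :: "nat \<Rightarrow> (nat \<Rightarrow> nat) \<Rightarrow> nat list pair_pre_digraph" where
  "grid k n = cartesian_products (map (\<lambda>i. path_graph (n i)) [1..<Suc k])"

definition open_neighbourhood :: "'a pair_pre_digraph \<Rightarrow> 'a \<Rightarrow> 'a set" where
  "open_neighbourhood G v = {w. (v, w) \<in> parcs G}"

definition move_or_stay :: "'a pair_pre_digraph \<Rightarrow> 'a \<Rightarrow> 'a \<Rightarrow> bool" where
  "move_or_stay G u v \<longleftrightarrow> v = u \<or> v \<in> open_neighbourhood G u"

text \<open>
  \<open>p 0\<close> is the vertex on which the president is placed, and \<open>p t\<close> is the president's vertex after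
  the president's \<open>t\<close>-th turn.
\<close>

definition president_play :: "'a pair_pre_digraph \<Rightarrow> (nat \<Rightarrow> 'a) \<Rightarrow> bool" where
  "president_play G p \<longleftrightarrow> p 0 \<in> pverts G \<and> (\<forall>t. move_or_stay G (p t) (p (Suc t)))"

text \<open>
  A strategy of the bodyguards maps the sequence of all president positions seen so far to the
  positions of the bodyguards, who are numbered \<open>0, \<dots>, m - 1\<close>. Since the strategy is fixed, the
  president's positions determine the whole history of the play. On the empty history the strategy
  gives the initial placement. After \<open>t\<close> bodyguard turns the bodyguards have seen exactly
  \<open>p 0, \<dots>, p (t - 1)\<close>.
\<close>

type_synonym 'a strategy = "'a list \<Rightarrow> nat \<Rightarrow> 'a"

definition bodyguards_at :: "'a strategy \<Rightarrow> (nat \<Rightarrow> 'a) \<Rightarrow> nat \<Rightarrow> nat \<Rightarrow> 'a" where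
  "bodyguards_at \<sigma> p t = \<sigma> (map p [0..<t])"

definition legal_strategy :: "'a pair_pre_digraph \<Rightarrow> nat \<Rightarrow> 'a strategy \<Rightarrow> bool" where
  "legal_strategy G m \<sigma> \<longleftrightarrow> (\<forall>i<m. \<sigma> [] i \<in> pverts G) \<and>
     (\<forall>p. president_play G p \<longrightarrow>
       (\<forall>t. \<forall>i<m. move_or_stay G (bodyguards_at \<sigma> p t i) (bodyguards_at \<sigma> p (Suc t) i)))"

definition surrounded :: "'a pair_pre_digraph \<Rightarrow> 'a set \<Rightarrow> 'a \<Rightarrow> bool" where
  "surrounded G B v \<longleftrightarrow> open_neighbourhood G v \<subseteq> B"

text \<open>
  At the end of bodyguard turn \<open>t + 1\<close> the president is still on \<open>p t\<close>.
\<close>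

definition winning_strategy :: "'a pair_pre_digraph \<Rightarrow> nat \<Rightarrow> 'a strategy \<Rightarrow> bool" where
  "winning_strategy G m \<sigma> \<longleftrightarrow> legal_strategy G m \<sigma> \<and>
     (\<forall>p. president_play G p \<longrightarrow>
       (\<exists>T. \<forall>t\<ge>T. surrounded G (bodyguards_at \<sigma> p (Suc t) ` {..<m}) (p t)))"

definition bodyguards_win :: "'a pair_pre_digraph \<Rightarrow> nat \<Rightarrow> bool" where
  "bodyguards_win G m \<longleftrightarrow> (\<exists>\<sigma>. winning_strategy G m \<sigma>)"

definition bodyguard_number :: "'a pair_pre_digraph \<Rightarrow> nat" where
  "bodyguard_number G = (LEAST m. bodyguards_win G m)"

text \<open>The minimum is attained on every finite graph: one bodyguard per vertex always wins.\<close>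

lemma bodyguards_win_card_verts:
  assumes "pair_fin_digraph G"
  shows "bodyguards_win G (card (pverts G))"
proof -
  interpret pair_fin_digraph G by fact
  obtain f where f: "bij_betw f {..<card (pverts G)} (pverts G)"
    using ex_bij_betw_nat_finite[OF pair_finite_verts] by (auto simp: lessThan_atLeast0)
  have "winning_strategy G (card (pverts G)) (\<lambda>_. f)"
    using f bij_betw_imp_surj_on[OF f] in_arcsD2
    by (auto simp: winning_strategy_def legal_strategy_def bodyguards_at_def move_or_stay_def
        surrounded_def open_neighbourhood_def)
  then show ?thesis unfolding bodyguards_win_def by blast
qed

lemma bodyguards_win_bodyguard_number:
  assumes "pair_fin_digraph G"
  shows "bodyguards_win G (bodyguard_number G)"
  unfolding bodyguard_number_def by (rule LeastI, rule bodyguards_win_card_verts, fact)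

lemma pair_graphI:
  assumes "finite (pverts G)"
    and "\<And>u v. (u, v) \<in> parcs G \<Longrightarrow>
      u \<in> pverts G \<and> v \<in> pverts G \<and> u \<noteq> v \<and> (v, u) \<in> parcs G"
  shows "pair_graph G"
proof -
  have "parcs G \<subseteq> pverts G \<times> pverts G" using assms(2) by auto
  then have fin: "finite (parcs G)" using assms(1) finite_subset by blast
  show ?thesis
    by unfold_locales (use assms fin in \<open>auto simp: symmetric_def sym_def\<close>)
qed

lemma pair_graphD:
  assumes "pair_graph G"
  shows "finite (pverts G)"
    and "(u, v) \<in> parcs G \<Longrightarrow>
      u \<in> pverts G \<and> v \<in> pverts G \<and> u \<noteq> v \<and> (v, u) \<in> parcs G"
proof -
  interpret pair_graph G by fact
  show "finite (pverts G)" by (rule pair_finite_verts)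
  show "u \<in> pverts G \<and> v \<in> pverts G \<and> u \<noteq> v \<and> (v, u) \<in> parcs G"
    if "(u, v) \<in> parcs G"
    using that in_arcsD1 in_arcsD2 pair_no_loops[of "(u, v)"] pair_sym_arcs
    by (auto simp: symmetric_def dest: symD)
qed

lemma pair_graph_path_graph: "pair_graph (path_graph n)"
  by (rule pair_graphI) (auto simp: path_graph_def)

lemma pair_graph_cartesian_product:
  assumes "pair_graph G" "pair_graph H"
  shows "pair_graph (cartesian_product G H)"
  by (rule pair_graphI)
    (use pair_graphD[OF assms(1)] pair_graphD[OF assms(2)] in \<open>auto simp: cartesian_product_def\<close>)

lemma pair_graph_relabel:
  assumes "pair_graph G" "inj f"
  shows "pair_graph (relabel f G)"
  by (rule pair_graphI)
    (use pair_graphD[OF assms(1)] in \<open>force simp: relabel_def inj_eq[OF assms(2)]\<close>)+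

lemma pair_graph_cartesian_products:
  "(\<And>G. G \<in> set Gs \<Longrightarrow> pair_graph G) \<Longrightarrow> pair_graph (cartesian_products Gs)"
proof (induction Gs)
  case Nil
  show ?case by (rule pair_graphI) auto
next
  case (Cons G Gs)
  have "inj (\<lambda>(x :: 'a, xs). x # xs)" by (auto simp: inj_def)
  with Cons show ?case by (simp add: pair_graph_relabel pair_graph_cartesian_product)
qed

lemma pair_graph_grid: "pair_graph (grid k n)"
  unfolding grid_def by (rule pair_graph_cartesian_products) (auto simp: pair_graph_path_graph)

end

theory Submission
  imports Defs
begin

text \<open>
  For a president at \<open>p\<close>, the \<open>2k\<close> points \<open>p \<plusminus> e\<^sub>i\<close>, clamped to the grid, cover the neighbourhood of
  \<open>p\<close>, and each of them moves like a token when the president does. A guard that has caught such a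
  target can therefore stay on it forever, so the guards catch the targets one after the other. As
  long as a target is missing, at least \<open>\<lfloor>k/2\<rfloor> + 1\<close> guards are free.

  That many free guards \<open>c\<^sub>a\<close> catch a single token \<open>r\<close>. A guard within distance \<open>1\<close> of \<open>r\<close> catches it
  at once. Otherwise one distinguished guard keeps distance at least \<open>1\<close> and all others at least \<open>2\<close>,
  so the distances sum to at least \<open>k\<close>, and none of them ever grows. If the token stays put, the
  distinguished guard comes closer; if it moves towards some guard, that distance drops. Suppose it
  moves away from every guard, in coordinate \<open>j\<close>. If some guard differs from \<open>r\<close> in coordinate \<open>j\<close>, all
  guards copy the move, which can happen only finitely often in a row because the token approaches
  the wall. If no guard does, then by pigeonhole some coordinate \<open>i \<noteq> j\<close> has total difference at
  least \<open>2\<close>; one guard reduces its difference in \<open>i\<close> instead of copying the move, and now \<open>j\<close> is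
  covered as well while \<open>i\<close> stays covered.
\<close>

section \<open>The grid as a box with the \<open>\<ell>\<^sub>1\<close>-metric\<close>

lemma mem_pverts_cartesian_products:
  "xs \<in> pverts (cartesian_products Gs) \<longleftrightarrow>
     length xs = length Gs \<and> (\<forall>i<length Gs. xs ! i \<in> pverts (Gs ! i))"
proof (induction Gs arbitrary: xs)
  case (Cons G Gs)
  show ?case
    by (cases xs) (auto simp: relabel_def cartesian_product_def Cons.IH image_iff
        less_Suc_eq_0_disj)
qed auto

lemma mem_parcs_cartesian_products:
  "(xs, ys) \<in> parcs (cartesian_products Gs) \<longleftrightarrow>
     xs \<in> pverts (cartesian_products Gs) \<and> ys \<in> pverts (cartesian_products Gs) \<and>
     (\<exists>i<length Gs. (xs ! i, ys ! i) \<in> parcs (Gs ! i) \<and>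
        (\<forall>j<length Gs. j \<noteq> i \<longrightarrow> xs ! j = ys ! j))"
proof (induction Gs arbitrary: xs ys)
  case (Cons G Gs)
  show ?case
  proof (cases "xs = [] \<or> ys = []")
    case True
    then show ?thesis
      by (auto simp: relabel_def cartesian_product_def)
  next
    case False
    then obtain x xs' y ys' where xy: "xs = x # xs'" "ys = y # ys'"
      by (meson neq_Nil_conv)
    \<comment> \<open>Membership fixes the lengths, so equality of the tails amounts to equality in
      every coordinate.\<close>
    have eq: "xs' = ys' \<longleftrightarrow> (\<forall>j<length Gs. xs' ! j = ys' ! j)"
      if "xs' \<in> pverts (cartesian_products Gs)" "ys' \<in> pverts (cartesian_products Gs)"
      using that by (auto simp: mem_pverts_cartesian_products intro: nth_equalityI)
    have "(xs, ys) \<in> parcs (cartesian_products (G # Gs)) \<longleftrightarrow>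
        ((x, xs'), (y, ys')) \<in> parcs (cartesian_product G (cartesian_products Gs))"
      by (force simp: xy relabel_def)
    also have "\<dots> \<longleftrightarrow> x \<in> pverts G \<and> xs' \<in> pverts (cartesian_products Gs) \<and>
        y \<in> pverts G \<and> ys' \<in> pverts (cartesian_products Gs) \<and>
        ((x, y) \<in> parcs G \<and> xs' = ys' \<or> x = y \<and> (xs', ys') \<in> parcs (cartesian_products Gs))"
      by (auto simp: cartesian_product_def)
    also have "\<dots> \<longleftrightarrow> xs \<in> pverts (cartesian_products (G # Gs)) \<and>
        ys \<in> pverts (cartesian_products (G # Gs)) \<and>
        ((x, y) \<in> parcs G \<and> (\<forall>j<length Gs. xs' ! j = ys' ! j) \<or>
         x = y \<and> (\<exists>i<length Gs. (xs' ! i, ys' ! i) \<in> parcs (Gs ! i) \<and>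
        (\<forall>j<length Gs. j \<noteq> i \<longrightarrow> xs' ! j = ys' ! j)))"
      using eq by (auto simp: xy relabel_def cartesian_product_def Cons.IH)
    also have "((x, y) \<in> parcs G \<and> (\<forall>j<length Gs. xs' ! j = ys' ! j) \<or>
         x = y \<and> (\<exists>i<length Gs. (xs' ! i, ys' ! i) \<in> parcs (Gs ! i) \<and>
        (\<forall>j<length Gs. j \<noteq> i \<longrightarrow> xs' ! j = ys' ! j))) \<longleftrightarrow>
        (\<exists>i<length (G # Gs). (xs ! i, ys ! i) \<in> parcs ((G # Gs) ! i) \<and>
        (\<forall>j<length (G # Gs). j \<noteq> i \<longrightarrow> xs ! j = ys ! j))"
      by (auto simp add: xy Ex_less_Suc2 All_less_Suc2)
    finally show ?thesis .
  qed
qed auto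

text \<open>On \<^typ>\<open>nat\<close> one of the two truncated differences is always \<open>0\<close>.\<close>

abbreviation nat_dist :: "nat \<Rightarrow> nat \<Rightarrow> nat" where
  "nat_dist x y \<equiv> (x - y) + (y - x)"

definition l1_dist :: "nat \<Rightarrow> nat list \<Rightarrow> nat list \<Rightarrow> nat" where
  "l1_dist k u v = (\<Sum>i<k. nat_dist (u ! i) (v ! i))"

definition box :: "nat \<Rightarrow> (nat \<Rightarrow> nat) \<Rightarrow> nat list set" where
  "box k s = {xs. length xs = k \<and> (\<forall>i<k. 1 \<le> xs ! i \<and> xs ! i \<le> s i)}"

text \<open>Only summand \<open>i\<close> differs. The additive form avoids truncated subtraction,
  and letting both points vary covers moves of guards and of the token alike.\<close>

lemma l1_dist_change:
  assumes "i < k" "\<And>m. m < k \<Longrightarrow> m \<noteq> i \<Longrightarrow> nat_dist (u ! m) (v ! m) = nat_dist (u' ! m) (v' ! m)"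
  shows "l1_dist k u v + nat_dist (u' ! i) (v' ! i) = l1_dist k u' v' + nat_dist (u ! i) (v ! i)"
proof -
  have "l1_dist k a b = nat_dist (a ! i) (b ! i) + (\<Sum>m\<in>{..<k} - {i}. nat_dist (a ! m) (b ! m))" for a b
    unfolding l1_dist_def using assms(1) by (intro sum.remove) auto
  moreover have "(\<Sum>m\<in>{..<k} - {i}. nat_dist (u ! m) (v ! m)) = (\<Sum>m\<in>{..<k} - {i}. nat_dist (u' ! m) (v' ! m))"
    using assms(2) by (intro sum.cong) auto
  ultimately show ?thesis by simp
qed

lemma l1_dist_self [simp]: "l1_dist k u u = 0"
  by (simp add: l1_dist_def)

lemma l1_dist_eq_0_iff: "l1_dist k u v = 0 \<longleftrightarrow> (\<forall>i<k. u ! i = v ! i)"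
  by (auto simp: l1_dist_def intro: antisym)

lemma box_eqI: "u \<in> box k s \<Longrightarrow> v \<in> box k s \<Longrightarrow> l1_dist k u v = 0 \<Longrightarrow> u = v"
  by (auto simp: box_def l1_dist_eq_0_iff intro: nth_equalityI)

lemma l1_dist_eq_1D:
  assumes "l1_dist k u v = 1"
  obtains i where "i < k" "nat_dist (u ! i) (v ! i) = 1" "\<And>m. m < k \<Longrightarrow> m \<noteq> i \<Longrightarrow> u ! m = v ! m"
proof -
  obtain i where i: "i < k" "nat_dist (u ! i) (v ! i) = 1"
     "\<forall>m<k. m \<noteq> i \<longrightarrow> nat_dist (u ! m) (v ! m) = 0"
    using assms unfolding l1_dist_def by (subst (asm) sum_eq_1_iff) auto
  then show thesis by (intro that[of i]) auto
qed

lemma pverts_grid: "pverts (grid k n) = box k (\<lambda>i. n (Suc i))"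
  by (auto simp: grid_def mem_pverts_cartesian_products box_def path_graph_def nth_append simp del: upt_Suc)

lemma mem_parcs_grid:
  "(u, v) \<in> parcs (grid k n) \<longleftrightarrow>
     u \<in> box k (\<lambda>i. n (Suc i)) \<and> v \<in> box k (\<lambda>i. n (Suc i)) \<and> l1_dist k u v = 1"
proof -
  have "(u, v) \<in> parcs (grid k n) \<longleftrightarrow> u \<in> pverts (grid k n) \<and> v \<in> pverts (grid k n) \<and>
      (\<exists>i<k. (u ! i, v ! i) \<in> parcs (path_graph (n (Suc i))) \<and> (\<forall>j<k. j \<noteq> i \<longrightarrow> u ! j = v ! j))"
    by (auto simp: grid_def mem_parcs_cartesian_products simp del: upt_Suc)
  also have "\<dots> \<longleftrightarrow> u \<in> box k (\<lambda>i. n (Suc i)) \<and> v \<in> box k (\<lambda>i. n (Suc i)) \<and>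
      (\<exists>i<k. nat_dist (u ! i) (v ! i) = 1 \<and> (\<forall>j<k. j \<noteq> i \<longrightarrow> u ! j = v ! j))"
    unfolding pverts_grid
    by (intro conj_cong refl ex_cong1) (auto simp: path_graph_def box_def)
  also have "(\<exists>i<k. nat_dist (u ! i) (v ! i) = 1 \<and> (\<forall>j<k. j \<noteq> i \<longrightarrow> u ! j = v ! j)) \<longleftrightarrow> l1_dist k u v = 1"
  proof
    assume "\<exists>i<k. nat_dist (u ! i) (v ! i) = 1 \<and> (\<forall>j<k. j \<noteq> i \<longrightarrow> u ! j = v ! j)"
    then obtain i where "i < k" "nat_dist (u ! i) (v ! i) = 1" "\<forall>j<k. j \<noteq> i \<longrightarrow> u ! j = v ! j" by blast
    with l1_dist_change[of i k u v u u] show "l1_dist k u v = 1" by simp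
  qed (metis l1_dist_eq_1D)
  finally show ?thesis .
qed

text \<open>Distance 0 inside the box forces \<open>v = u\<close>, the case of staying put; distance
  1 is adjacency.\<close>

lemma move_or_stay_grid:
  assumes "u \<in> box k (\<lambda>i. n (Suc i))"
  shows "move_or_stay (grid k n) u v \<longleftrightarrow> v \<in> box k (\<lambda>i. n (Suc i)) \<and> l1_dist k u v \<le> 1"
  using assms box_eqI[of u k "\<lambda>i. n (Suc i)" v]
  by (auto simp: move_or_stay_def open_neighbourhood_def mem_parcs_grid le_Suc_eq)

section \<open>Catching a token with half as many guards as dimensions\<close>

definition nudge :: "nat list \<Rightarrow> nat list \<Rightarrow> nat \<Rightarrow> nat list" where
  "nudge c r i = c[i := if c ! i < r ! i then c ! i + 1 else if r ! i < c ! i then c ! i - 1 else c ! i]"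

text \<open>The new coordinate lies between those of \<open>c\<close> and \<open>r\<close>.\<close>

lemma nudge_in_box:
  assumes "c \<in> box k s" "r \<in> box k s" "i < k"
  shows "nudge c r i \<in> box k s"
  using assms by (auto simp: nudge_def box_def nth_list_update)

lemma nth_nudge:
  assumes "length c = k" "i < k" "m < k"
  shows "nudge c r i ! m = (if m = i then if c ! i < r ! i then c ! i + 1 else if r ! i < c ! i then c ! i - 1 else c ! i
           else c ! m)"
  using assms by (auto simp: nudge_def nth_list_update)

lemma l1_dist_nudge_self:
  assumes "length c = k" "i < k"
  shows "l1_dist k c (nudge c r i) \<le> 1"
proof -
  have "l1_dist k c (nudge c r i) + nat_dist (c ! i) (c ! i)
      = l1_dist k c c + nat_dist (c ! i) (nudge c r i ! i)"
    using assms by (intro l1_dist_change) (auto simp: nth_nudge)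
  then show ?thesis using assms by (auto simp: nth_nudge split: if_splits)
qed

lemma l1_dist_nudge:
  assumes "length c = k" "i < k" "c ! i \<noteq> r ! i"
  shows "Suc (l1_dist k (nudge c r i) r) = l1_dist k c r"
proof -
  have "l1_dist k (nudge c r i) r + nat_dist (c ! i) (r ! i)
      = l1_dist k c r + nat_dist (nudge c r i ! i) (r ! i)"
    using assms by (intro l1_dist_change) (auto simp: nth_nudge)
  then show ?thesis using assms by (auto simp: nth_nudge split: if_splits)
qed

section \<open>Progress measure of the chase\<close>

text \<open>The exceptional guard \<open>a0\<close> may change from round to round. What counts is
  that the distances sum to at least \<open>2 * card A - 1\<close>.\<close>

definition spread :: "nat \<Rightarrow> 'g set \<Rightarrow> ('g \<Rightarrow> nat list) \<Rightarrow> nat list \<Rightarrow> bool" where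
  "spread k A c r \<longleftrightarrow> (\<exists>a0\<in>A. 1 \<le> l1_dist k (c a0) r \<and> (\<forall>a\<in>A - {a0}. 2 \<le> l1_dist k (c a) r))"

definition uncovered :: "nat \<Rightarrow> 'g set \<Rightarrow> ('g \<Rightarrow> nat list) \<Rightarrow> nat list \<Rightarrow> nat set" where
  "uncovered k A c r = {i. i < k \<and> (\<forall>a\<in>A. c a ! i = r ! i)}"

text \<open>An upper bound on how often a token at \<open>y\<close> in \<open>{1..s}\<close> can still move away from \<open>x\<close>.\<close>

definition room :: "nat \<Rightarrow> nat \<Rightarrow> nat \<Rightarrow> nat" where
  "room s x y = (if x < y then s - y else if y < x then y else 0)"

text \<open>\<open>x + y' - y\<close> is where a guard at \<open>x\<close> ends up when it copies
  the token's move from \<open>y\<close> to \<open>y'\<close>.\<close>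

lemma room_away_le:
  assumes "nat_dist y y' = 1" "nat_dist x y < nat_dist x y'"
  shows "room s (x + y' - y) y' \<le> room s x y"
proof -
  consider "x < y" "y' = Suc y" | "y < x" "y = Suc y'" | "x = y" using assms by linarith
  then show ?thesis by cases (simp_all add: room_def)
qed

text \<open>For an upward move \<open>y' \<le> s\<close> gives \<open>y < s\<close>, so the
  truncated \<open>s - y\<close> really drops.\<close>

lemma room_away_less:
  assumes "nat_dist y y' = 1" "nat_dist x y < nat_dist x y'" "x \<noteq> y" "y' \<le> s"
  shows "room s (x + y' - y) y' < room s x y"
proof -
  consider "x < y" "y' = Suc y" | "y < x" "y = Suc y'" using assms by linarith
  then show ?thesis using assms(4) by cases (simp_all add: room_def)
qed

definition total_room :: "nat \<Rightarrow> (nat \<Rightarrow> nat) \<Rightarrow> 'g set \<Rightarrow> ('g \<Rightarrow> nat list) \<Rightarrow> nat list \<Rightarrow> nat" where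
  "total_room k s A c r = (\<Sum>a\<in>A. \<Sum>i<k. room (s i) (c a ! i) (r ! i))"

text \<open>To be compared lexicographically. The order matters: distances may grow in the round
  that establishes \<open>spread\<close>, lowering the total distance may uncover coordinates, and
  \<open>total_room\<close> may grow whenever an earlier component drops.\<close>

definition chase_measure ::
    "nat \<Rightarrow> (nat \<Rightarrow> nat) \<Rightarrow> 'g set \<Rightarrow> ('g \<Rightarrow> nat list) \<Rightarrow> nat list \<Rightarrow> nat \<times> nat \<times> nat \<times> nat" where
  "chase_measure k s A c r = (of_bool (\<not> spread k A c r), \<Sum>a\<in>A. l1_dist k (c a) r,
     card (uncovered k A c r), total_room k s A c r)"

definition chase_order :: "((nat \<times> nat \<times> nat \<times> nat) \<times> (nat \<times> nat \<times> nat \<times> nat)) set" where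
  "chase_order = less_than <*lex*> less_than <*lex*> less_than <*lex*> less_than"

lemma wf_chase_order: "wf chase_order"
  by (auto simp: chase_order_def)

text \<open>By \<open>spread\<close> the total distance is at least \<open>2 * card A - 1\<close>,
  hence at least \<open>k\<close>, but at most \<open>k - 1\<close> coordinates contribute. So some
  coordinate \<open>i\<close> has total difference at least 2: guard \<open>b\<close> can give up
  one unit there, and \<open>i\<close> stays covered by \<open>b\<close> itself or by another
  guard.\<close>

lemma chase_pigeonhole:
  assumes "finite A" "k < 2 * card A" "spread k A c r" "uncovered k A c r \<noteq> {}"
  obtains i b where "i < k" "b \<in> A" "c b ! i \<noteq> r ! i"
    "nat_dist (c b ! i) (r ! i) \<ge> 2 \<or> (\<exists>a\<in>A. a \<noteq> b \<and> c a ! i \<noteq> r ! i)"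
proof -
  obtain a0 where a0: "a0 \<in> A" "1 \<le> l1_dist k (c a0) r" "\<And>a. a \<in> A - {a0} \<Longrightarrow> 2 \<le> l1_dist k (c a) r"
    using assms(3) by (auto simp: spread_def)
  define S where "S i = (\<Sum>a\<in>A. nat_dist (c a ! i) (r ! i))" for i
  obtain j where j: "j < k" "S j = 0"
    using assms(1,4) by (auto simp: uncovered_def S_def)
  have "(\<Sum>a\<in>A. l1_dist k (c a) r) = l1_dist k (c a0) r + (\<Sum>a\<in>A - {a0}. l1_dist k (c a) r)"
    using assms(1) a0(1) by (rule sum.remove)
  moreover have "(\<Sum>a\<in>A - {a0}. 2) \<le> (\<Sum>a\<in>A - {a0}. l1_dist k (c a) r)"
    using a0(3) by (intro sum_mono) auto
  moreover have "card A = Suc (card (A - {a0}))"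
    using assms(1) a0(1) by (simp only: card_Suc_Diff1)
  ultimately have "k \<le> (\<Sum>a\<in>A. l1_dist k (c a) r)"
    using a0(2) assms(2) by simp
  also have "\<dots> = (\<Sum>i<k. S i)"
    unfolding l1_dist_def S_def by (rule sum.swap)
  also have "\<dots> = (\<Sum>i\<in>{..<k} - {j}. S i)"
    using j by (subst sum.remove[of _ j]) auto
  finally have ge: "k \<le> (\<Sum>i\<in>{..<k} - {j}. S i)" .
  have "\<exists>i\<in>{..<k} - {j}. 2 \<le> S i"
  proof (rule ccontr)
    assume "\<not> ?thesis"
    then have "(\<Sum>i\<in>{..<k} - {j}. S i) \<le> (\<Sum>i\<in>{..<k} - {j}. 1)"
      by (intro sum_mono) force
    with ge j show False by simp
  qed
  then obtain i where i: "i < k" "2 \<le> S i" by auto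
  then have "\<exists>b\<in>A. nat_dist (c b ! i) (r ! i) \<noteq> 0"
    unfolding S_def by (metis (no_types, lifting) not_numeral_le_zero sum.neutral)
  then obtain b where b: "b \<in> A" "c b ! i \<noteq> r ! i"
    by auto
  have "nat_dist (c b ! i) (r ! i) \<ge> 2 \<or> (\<exists>a\<in>A. a \<noteq> b \<and> c a ! i \<noteq> r ! i)"
  proof (rule ccontr)
    assume neg: "\<not> ?thesis"
    have "S i = nat_dist (c b ! i) (r ! i) + (\<Sum>a\<in>A - {b}. nat_dist (c a ! i) (r ! i))"
      unfolding S_def using assms(1) b(1) by (rule sum.remove)
    also have "(\<Sum>a\<in>A - {b}. nat_dist (c a ! i) (r ! i)) = 0"
      using neg by (intro sum.neutral) auto
    finally show False using neg i(2) by linarith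
  qed
  with i b that show thesis by blast
qed

section \<open>One round of the chase\<close>

text \<open>Every distance has grown by 1, so one step of each guard can at best restore the old
  distances. The first two components of the measure are kept, and the third or the fourth has to
  drop.\<close>

lemma chase_step_all_away:
  assumes "finite A" "k < 2 * card A" "spread k A c r"
    and c: "\<And>a. a \<in> A \<Longrightarrow> c a \<in> box k s" and r: "r \<in> box k s" "r' \<in> box k s"
    and j: "j < k" "nat_dist (r ! j) (r' ! j) = 1" "\<And>m. m < k \<Longrightarrow> m \<noteq> j \<Longrightarrow> r ! m = r' ! m"
    and away: "\<And>a. a \<in> A \<Longrightarrow> l1_dist k (c a) r < l1_dist k (c a) r'"
  shows "\<exists>c'. (\<forall>a\<in>A. c' a \<in> box k s \<and> l1_dist k (c a) (c' a) \<le> 1) \<and>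
           (chase_measure k s A c' r', chase_measure k s A c r) \<in> chase_order"
proof -
  have len: "length (c a) = k" if "a \<in> A" for a using c[OF that] by (simp add: box_def)
  have dj: "l1_dist k (c a) r + nat_dist (c a ! j) (r' ! j) = l1_dist k (c a) r' + nat_dist (c a ! j) (r ! j)" if "a \<in> A" for a
    using j by (intro l1_dist_change) auto
  have awayj: "nat_dist (c a ! j) (r ! j) < nat_dist (c a ! j) (r' ! j)" if "a \<in> A" for a
    using dj[OF that] away[OF that] by linarith
  have dj1: "l1_dist k (c a) r' = Suc (l1_dist k (c a) r)" if "a \<in> A" for a
    using dj[OF that] awayj[OF that] j(2) by linarith
  have neqj: "c a ! j \<noteq> r' ! j" if "a \<in> A" for a
    using awayj[OF that] by auto
  \<comment> \<open>Any choice of nonzero coordinates to be reduced restores all distances.\<close>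
  have nudges: "(\<forall>a\<in>A. nudge (c a) r' (h a) \<in> box k s \<and> l1_dist k (c a) (nudge (c a) r' (h a)) \<le> 1)
      \<and> spread k A (\<lambda>a. nudge (c a) r' (h a)) r'
      \<and> (\<Sum>a\<in>A. l1_dist k (nudge (c a) r' (h a)) r') = (\<Sum>a\<in>A. l1_dist k (c a) r)"
    if h: "\<And>a. a \<in> A \<Longrightarrow> h a < k \<and> c a ! h a \<noteq> r' ! h a" for h
  proof -
    have eq: "l1_dist k (nudge (c a) r' (h a)) r' = l1_dist k (c a) r" if "a \<in> A" for a
      using l1_dist_nudge[of "c a" k "h a" r'] len[OF that] h[OF that] dj1[OF that] by simp
    have "spread k A (\<lambda>a. nudge (c a) r' (h a)) r'"
      using assms(3) eq by (auto simp: spread_def)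
    with eq show ?thesis
      using c r h len by (auto intro: nudge_in_box l1_dist_nudge_self simp del: One_nat_def)
  qed
  \<comment> \<open>As the token moved away from every guard, a step towards \<open>r'\<close> in
    coordinate \<open>j\<close> has the direction of the token's move: nudging there is
    copying.\<close>
  have follow: "nudge (c a) r' j ! m = (if m = j then c a ! j + r' ! j - r ! j else c a ! m)"
    if "a \<in> A" "m < k" for a m
    using awayj[OF that(1)] j(1,2) that len[OF that(1)] by (auto simp: nth_nudge)
  show ?thesis
  proof (cases "j \<in> uncovered k A c r")
    case False
    then obtain b where b: "b \<in> A" "c b ! j \<noteq> r ! j"
      using j by (auto simp: uncovered_def)
    define c' where "c' a = nudge (c a) r' j" for a
    \<comment> \<open>Copying the move preserves all coordinate differences.\<close>
    have "uncovered k A c' r' = uncovered k A c r"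
    proof -
      have "c' a ! m = r' ! m \<longleftrightarrow> c a ! m = r ! m" if "a \<in> A" "m < k" for a m
        using follow[OF that] awayj[OF that(1)] j(2) j(3)[OF that(2)] by (auto simp: c'_def)
      then show ?thesis by (auto simp: uncovered_def)
    qed
    \<comment> \<open>No term grows, and the one of \<open>b\<close> in coordinate \<open>j\<close>
      drops because \<open>b\<close> differs from the token there.\<close>
    moreover have "total_room k s A c' r' < total_room k s A c r"
    proof -
      have le: "room (s m) (c' a ! m) (r' ! m) \<le> room (s m) (c a ! m) (r ! m)" if "a \<in> A" "m < k" for a m
        using follow[OF that] room_away_le[OF j(2) awayj[OF that(1)]] j(3)[OF that(2)]
        by (cases "m = j") (simp_all add: c'_def)
      have "room (s j) (c' b ! j) (r' ! j) < room (s j) (c b ! j) (r ! j)"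
        using follow[OF b(1) j(1)] room_away_less[OF j(2) awayj[OF b(1)] b(2)] r(2) j(1)
        by (simp add: c'_def box_def)
      then have "(\<Sum>i<k. room (s i) (c' b ! i) (r' ! i)) < (\<Sum>i<k. room (s i) (c b ! i) (r ! i))"
        using le[OF b(1)] j(1) by (intro sum_strict_mono_ex1) auto
      then show ?thesis
        unfolding total_room_def using b(1) le assms(1)
        by (intro sum_strict_mono_ex1) (auto intro!: sum_mono)
    qed
    moreover note nudges[of "\<lambda>_. j"] neqj j(1) assms(3)
    ultimately show ?thesis
      by (intro exI[of _ c']) (simp add: c'_def[abs_def] chase_measure_def chase_order_def)
  next
    case True
    with chase_pigeonhole[OF assms(1-3)] obtain i b where ib: "i < k" "b \<in> A" "c b ! i \<noteq> r ! i"
      "nat_dist (c b ! i) (r ! i) \<ge> 2 \<or> (\<exists>a\<in>A. a \<noteq> b \<and> c a ! i \<noteq> r ! i)" by blast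
    have ij: "i \<noteq> j" using True ib by (auto simp: uncovered_def)
    \<comment> \<open>Guard \<open>b\<close> steps in \<open>i\<close> while all others copy the
      move in \<open>j\<close>. Not copying leaves \<open>b\<close> behind in \<open>j\<close>,
      which thereby becomes covered.\<close>
    define h where "h a = (if a = b then i else j)" for a
    define c' where "c' a = nudge (c a) r' (h a)" for a
    have h: "h a < k \<and> c a ! h a \<noteq> r' ! h a" if "a \<in> A" for a
      using ib j ij neqj[OF that] by (auto simp: h_def)
    have "uncovered k A c' r' \<subseteq> uncovered k A c r - {j}"
    proof
      fix m assume m: "m \<in> uncovered k A c' r'"
      then have mk: "m < k" and eq: "\<And>a. a \<in> A \<Longrightarrow> c' a ! m = r' ! m" by (auto simp: uncovered_def)
      have b': "c' b ! m' = (if m' = i then if c b ! i < r' ! i then c b ! i + 1 else c b ! i - 1 else c b ! m')"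
        if "m' < k" for m'
        using ib ij j(3)[of i] that len[OF ib(2)] by (auto simp: c'_def h_def nth_nudge)
      have mj: "m \<noteq> j"
        using eq[OF ib(2)] b'[OF mk] neqj[OF ib(2)] ij by auto
      have a': "c' a ! m = c a ! m" if "a \<in> A" "a \<noteq> b" for a
        using follow[OF that(1) mk] mj that by (simp add: c'_def h_def)
      \<comment> \<open>If \<open>i\<close> were now uncovered, \<open>b\<close> would have closed a
        gap of 1 there, so the pigeonhole alternative yields another guard differing in
        \<open>i\<close>, and that guard did not move in \<open>i\<close>.\<close>
      have mi: "m \<noteq> i"
      proof
        assume "m = i"
        then have "nat_dist (c b ! i) (r ! i) \<le> 1"
          using eq[OF ib(2)] b'[OF mk] j(3)[OF ib(1) ij] ib(3) by (auto split: if_splits)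
        with ib(4) obtain a where "a \<in> A" "a \<noteq> b" "c a ! i \<noteq> r ! i" by auto
        with a' eq \<open>m = i\<close> j(3)[OF ib(1) ij] show False by metis
      qed
      have "c a ! m = r ! m" if "a \<in> A" for a
        using eq[OF that] a'[OF that] b'[OF mk] mi j(3)[OF mk mj] by (cases "a = b") auto
      with mk mj show "m \<in> uncovered k A c r - {j}" by (auto simp: uncovered_def)
    qed
    then have "card (uncovered k A c' r') < card (uncovered k A c r)"
      using True by (intro psubset_card_mono) (auto simp: uncovered_def)
    with nudges[of h] h assms(3) show ?thesis
      by (intro exI[of _ c']) (simp add: c'_def[abs_def] chase_measure_def chase_order_def)
  qed
qed

text \<open>The guards answer the move to \<open>r'\<close>, so a guard within distance 1 of
  \<open>r'\<close> catches at once. Otherwise all distances to \<open>r'\<close> are at least 2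
  before the guards move, which leaves one guard free to come closer without destroying
  \<open>spread\<close>.\<close>

lemma chase_step:
  assumes "finite A" "k < 2 * card A"
    and c: "\<And>a. a \<in> A \<Longrightarrow> c a \<in> box k s" and r: "r \<in> box k s" "r' \<in> box k s" "l1_dist k r r' \<le> 1"
  shows "\<exists>c'. (\<forall>a\<in>A. c' a \<in> box k s \<and> l1_dist k (c a) (c' a) \<le> 1) \<and>
           ((\<exists>a\<in>A. c' a = r') \<or> (chase_measure k s A c' r', chase_measure k s A c r) \<in> chase_order)"
proof -
  consider (near) a where "a \<in> A" "l1_dist k (c a) r' \<le> 1"
    | (far) "\<And>a. a \<in> A \<Longrightarrow> 2 \<le> l1_dist k (c a) r'"
    by force
  then show ?thesis
  proof cases
    case near
    then show ?thesis using c r by (intro exI[of _ "c(a := r')"]) auto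
  next
    case far
    have ne: "A \<noteq> {}" using assms(2) by auto
    have len: "length (c a) = k" if "a \<in> A" for a using c[OF that] by (simp add: box_def)
    show ?thesis
    proof (cases "spread k A c r")
      case False
      \<comment> \<open>Standing still suffices: the first component of the measure drops.\<close>
      have "spread k A c r'" using far ne by (force simp: spread_def)
      with False c show ?thesis
        by (intro exI[of _ c]) (auto simp: chase_measure_def chase_order_def)
    next
      case True
      then obtain a0 where a0: "a0 \<in> A" "1 \<le> l1_dist k (c a0) r" "\<And>a. a \<in> A - {a0} \<Longrightarrow> 2 \<le> l1_dist k (c a) r"
        by (auto simp: spread_def)
      have ex: "\<exists>i<k. c a ! i \<noteq> r' ! i" if "a \<in> A" for a
        using far[OF that] l1_dist_eq_0_iff[of k "c a" r'] by auto
      show ?thesis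
      proof (cases "r' = r")
        case pass: True
        obtain i where i: "i < k" "c a0 ! i \<noteq> r' ! i" using ex[OF a0(1)] by blast
        define c' where "c' = c(a0 := nudge (c a0) r' i)"
        have a0': "Suc (l1_dist k (c' a0) r') = l1_dist k (c a0) r'"
          using l1_dist_nudge[OF len[OF a0(1)] i] by (simp add: c'_def)
        then have "spread k A c' r'"
          using a0(1) far far[OF a0(1)] unfolding spread_def
          by (intro bexI[of _ a0] conjI ballI) (linarith | simp add: c'_def)+
        moreover have "(\<Sum>a\<in>A. l1_dist k (c' a) r') < (\<Sum>a\<in>A. l1_dist k (c a) r)"
          using assms(1) a0(1) a0' pass by (intro sum_strict_mono_ex1) (auto simp: c'_def)
        ultimately have "(chase_measure k s A c' r', chase_measure k s A c r) \<in> chase_order"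
          using True by (simp add: chase_measure_def chase_order_def)
        moreover have "\<forall>a\<in>A. c' a \<in> box k s \<and> l1_dist k (c a) (c' a) \<le> 1"
          using c r i a0(1) len by (auto simp: c'_def simp del: One_nat_def intro: nudge_in_box l1_dist_nudge_self)
        ultimately show ?thesis by blast
      next
        case False
        then have "l1_dist k r r' = 1" using box_eqI[OF r(1,2)] r(3) by fastforce
        then obtain j where j: "j < k" "nat_dist (r ! j) (r' ! j) = 1" "\<And>m. m < k \<Longrightarrow> m \<noteq> j \<Longrightarrow> r ! m = r' ! m"
          by (rule l1_dist_eq_1D) blast
        have dj: "l1_dist k (c a) r + nat_dist (c a ! j) (r' ! j) = l1_dist k (c a) r' + nat_dist (c a ! j) (r ! j)" for a
          using j by (intro l1_dist_change) auto
        \<comment> \<open>A token's step changes every distance by exactly 1, so a guard from which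
          the token does not move away gets strictly nearer.\<close>
        have neq: "l1_dist k (c a) r' \<noteq> l1_dist k (c a) r" "l1_dist k (c a) r' \<le> Suc (l1_dist k (c a) r)" for a
          using dj[of a] j(2) by presburger+
        show ?thesis
        proof (cases "\<forall>a\<in>A. l1_dist k (c a) r < l1_dist k (c a) r'")
          case away: True
          show ?thesis
            using chase_step_all_away[OF assms(1,2) True c r(1,2) j] away by blast
        next
          case False
          then obtain b where b: "b \<in> A" "l1_dist k (c b) r' < l1_dist k (c b) r"
            using neq(1) by (metis linorder_neqE_nat)
          obtain h where h: "\<And>a. a \<in> A \<Longrightarrow> h a < k \<and> c a ! h a \<noteq> r' ! h a" using ex by metis
          define c' where
            "c' a = (if l1_dist k (c a) r < l1_dist k (c a) r' then nudge (c a) r' (h a) else c a)" for a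
          \<comment> \<open>Guards whose distance grew undo the growth; the others stand still and
            keep the gain.\<close>
          have d': "l1_dist k (c' a) r' = min (l1_dist k (c a) r) (l1_dist k (c a) r')" if "a \<in> A" for a
            using l1_dist_nudge[of "c a" k "h a" r'] len[OF that] h[OF that] neq[of a]
            by (auto simp: c'_def)
          have "spread k A c' r'"
            unfolding spread_def using a0 far d' by (intro bexI[of _ a0]) (force simp: le_Suc_eq)+
          moreover have "(\<Sum>a\<in>A. l1_dist k (c' a) r') < (\<Sum>a\<in>A. l1_dist k (c a) r)"
            using assms(1) b d' by (intro sum_strict_mono_ex1) (auto intro: bexI[of _ b])
          ultimately have "(chase_measure k s A c' r', chase_measure k s A c r) \<in> chase_order"
            using True by (simp add: chase_measure_def chase_order_def)
          moreover have "\<forall>a\<in>A. c' a \<in> box k s \<and> l1_dist k (c a) (c' a) \<le> 1"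
            using c r h len by (auto simp: c'_def simp del: One_nat_def intro: nudge_in_box l1_dist_nudge_self)
          ultimately show ?thesis by blast
        qed
      qed
    qed
  qed
qed

section \<open>Escorting the president\<close>

text \<open>The number \<open>\<tau>\<close> codes a coordinate, \<open>\<tau> div 2\<close>, and a
  direction, by its parity. At a wall the clamped target is \<open>p\<close> itself, so there are
  always \<open>2 * k\<close> codes to serve.\<close>

definition target :: "(nat \<Rightarrow> nat) \<Rightarrow> nat list \<Rightarrow> nat \<Rightarrow> nat list" where
  "target s p \<tau> = (let i = \<tau> div 2 in
     p[i := if even \<tau> then min (s i) (p ! i + 1) else max 1 (p ! i - 1)])"

lemma nth_target:
  assumes "m < length p"
  shows "target s p \<tau> ! m = (if m \<noteq> \<tau> div 2 then p ! m
    else if even \<tau> then min (s m) (p ! m + 1) else max 1 (p ! m - 1))"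
  using assms by (auto simp: target_def Let_def nth_list_update)

lemma target_in_box: "p \<in> box k s \<Longrightarrow> target s p \<tau> \<in> box k s"
  by (auto simp: box_def nth_target) (auto simp: target_def Let_def)

lemma nat_dist_min_Suc_le: "nat_dist (min a (x + 1)) (min a (y + 1)) \<le> nat_dist x y"
  by (cases "x \<le> y") (auto simp: min_def)

lemma nat_dist_max_pred_le: "nat_dist (max 1 (x - 1)) (max 1 (y - 1)) \<le> nat_dist x y"
  by (cases "x \<le> y") (auto simp: max_def)

text \<open>Clamped shifts do not expand distances in any coordinate, so a guard on a target can
  follow it in one move.\<close>

lemma l1_dist_target_le:
  assumes "p \<in> box k s" "p' \<in> box k s"
  shows "l1_dist k (target s p \<tau>) (target s p' \<tau>) \<le> l1_dist k p p'"
  unfolding l1_dist_def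
proof (rule sum_mono)
  fix m assume "m \<in> {..<k}"
  then have "m < length p" "m < length p'"
    using assms by (auto simp: box_def)
  then show "nat_dist (target s p \<tau> ! m) (target s p' \<tau> ! m) \<le> nat_dist (p ! m) (p' ! m)"
    using nat_dist_min_Suc_le[of "s m" "p ! m" "p' ! m"] nat_dist_max_pred_le[of "p ! m" "p' ! m"]
    by (simp only: nth_target split: if_split) blast
qed

text \<open>Since \<open>w\<close> lies in the box, clamping does not alter the target in its
  direction.\<close>

lemma neighbour_is_target:
  assumes "p \<in> box k s" "w \<in> box k s" "l1_dist k p w = 1"
  obtains \<tau> where "\<tau> < 2 * k" "w = target s p \<tau>"
proof -
  obtain i where i: "i < k" "nat_dist (p ! i) (w ! i) = 1" "\<And>m. m < k \<Longrightarrow> m \<noteq> i \<Longrightarrow> p ! m = w ! m"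
    using l1_dist_eq_1D[OF assms(3)] by blast
  define \<tau> where "\<tau> = (if p ! i < w ! i then 2 * i else Suc (2 * i))"
  have \<tau>: "\<tau> div 2 = i" "even \<tau> \<longleftrightarrow> p ! i < w ! i" "\<tau> < 2 * k" using i(1) by (auto simp: \<tau>_def)
  have "w ! m = target s p \<tau> ! m" if "m < k" for m
  proof (cases "m = i")
    case True
    have "i < length p" "1 \<le> w ! i" "w ! i \<le> s i" using i(1) assms(1,2) by (auto simp: box_def)
    then have "w ! i = (if p ! i < w ! i then min (s i) (p ! i + 1) else max 1 (p ! i - 1))"
      using i(2) by (auto simp: min_def max_def)
    also have "\<dots> = target s p \<tau> ! i"
      using \<open>i < length p\<close> \<tau> by (simp add: nth_target)
    finally show ?thesis using True by simp
  next
    case False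
    then show ?thesis using that assms(1) i(3) \<tau>(1) by (auto simp: nth_target box_def)
  qed
  then have "w = target s p \<tau>"
    using assms(2) target_in_box[OF assms(1)] by (intro nth_equalityI) (auto simp: box_def)
  with \<tau>(3) that show thesis by blast
qed

section \<open>The escort invariant\<close>

definition free_guards :: "nat \<Rightarrow> nat \<Rightarrow> (nat \<Rightarrow> nat) \<Rightarrow> nat set" where
  "free_guards N l f = {..<N} - f ` {..<l}"

text \<open>Invariant at the end of a bodyguard turn: the first \<open>l\<close> targets are held
  for good, and target \<open>l\<close>, if \<open>l < 2 * k\<close>, is the one being
  chased.\<close>

definition escort ::
    "nat \<Rightarrow> (nat \<Rightarrow> nat) \<Rightarrow> nat \<Rightarrow> nat \<Rightarrow> (nat \<Rightarrow> nat) \<Rightarrow> (nat \<Rightarrow> nat list) \<Rightarrow> nat list \<Rightarrow> bool" where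
  "escort k s N l f g p \<longleftrightarrow> l \<le> 2 * k \<and> inj_on f {..<l} \<and> f ` {..<l} \<subseteq> {..<N} \<and>
     (\<forall>a<N. g a \<in> box k s) \<and> p \<in> box k s \<and> (\<forall>\<tau><l. g (f \<tau>) = target s p \<tau>)"

lemma escort_step:
  assumes esc: "escort k s N l f g p" and N: "5 * k \<le> Suc (2 * N)"
    and p': "p' \<in> box k s" "l1_dist k p p' \<le> 1"
  shows "\<exists>l' f' g'. escort k s N l' f' g' p' \<and> (\<forall>a<N. l1_dist k (g a) (g' a) \<le> 1) \<and>
    (l = 2 * k \<and> l' = 2 * k \<or>
     l' = Suc l \<or>
     l' = l \<and> (chase_measure k s (free_guards N l' f') g' (target s p' l'),
               chase_measure k s (free_guards N l f) g (target s p l)) \<in> chase_order)"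
proof -
  have p: "p \<in> box k s" and inj: "inj_on f {..<l}" and fN: "f ` {..<l} \<subseteq> {..<N}"
    and l: "l \<le> 2 * k" and g: "\<And>a. a < N \<Longrightarrow> g a \<in> box k s"
    and gf: "\<And>\<tau>. \<tau> < l \<Longrightarrow> g (f \<tau>) = target s p \<tau>"
    using esc by (auto simp: escort_def)
  define A where "A = free_guards N l f"
  \<comment> \<open>Guards on duty follow their targets, found through the inverse of
    \<open>f\<close>; only free guards use the moves \<open>c\<close>.\<close>
  define cont where
    "cont c a = (if a \<in> A then c a else target s p' (inv_into {..<l} f a))" for c a
  have cont_f: "cont c (f \<tau>) = target s p' \<tau>" if "\<tau> < l" for c \<tau>
    using that inj by (auto simp: cont_def A_def free_guards_def)
  have cont: "escort k s N l f (cont c) p' \<and> (\<forall>a<N. l1_dist k (g a) (cont c a) \<le> 1)"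
    if c: "\<forall>a\<in>A. c a \<in> box k s \<and> l1_dist k (g a) (c a) \<le> 1" for c
  proof -
    have "cont c a \<in> box k s \<and> l1_dist k (g a) (cont c a) \<le> 1" if a: "a < N" for a
    proof (cases "a \<in> A")
      case True
      then show ?thesis using c by (auto simp: cont_def)
    next
      case False
      then obtain \<tau> where \<tau>: "\<tau> < l" "a = f \<tau>" using a by (auto simp: A_def free_guards_def)
      have "l1_dist k (target s p \<tau>) (target s p' \<tau>) \<le> 1"
        using l1_dist_target_le[OF p p'(1)] p'(2) by (rule order_trans)
      then show ?thesis
        using \<tau> gf cont_f target_in_box[OF p'(1)] by simp
    qed
    then show ?thesis
      using l inj fN p'(1) cont_f by (simp add: escort_def)
  qed
  show ?thesis
  proof (cases "l = 2 * k")
    case True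
    then show ?thesis using cont[of g] g by (auto simp: A_def free_guards_def)
  next
    case False
    have "card A = N - l"
      unfolding A_def free_guards_def using fN inj by (subst card_Diff_subset) (auto simp: card_image)
    \<comment> \<open>Here the bound on \<open>N\<close> enters: \<open>l \<le> 2 * k - 1\<close>
      gives \<open>2 * (N - l) \<ge> 5 * k - 1 - (4 * k - 2) = k + 1\<close>.\<close>
    then have "k < 2 * card A" using N l False by linarith
    moreover have "finite A" "\<And>a. a \<in> A \<Longrightarrow> g a \<in> box k s"
      using g by (auto simp: A_def free_guards_def)
    moreover have "l1_dist k (target s p l) (target s p' l) \<le> 1"
      using l1_dist_target_le[OF p p'(1)] p'(2) by (rule order_trans)
    ultimately obtain c where c: "\<forall>a\<in>A. c a \<in> box k s \<and> l1_dist k (g a) (c a) \<le> 1"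
      and disj: "(\<exists>a\<in>A. c a = target s p' l) \<or>
        (chase_measure k s A c (target s p' l), chase_measure k s A g (target s p l)) \<in> chase_order"
      using chase_step[of A k g s "target s p l" "target s p' l"] target_in_box p p'(1) by blast
    from disj show ?thesis
    proof
      assume "\<exists>a\<in>A. c a = target s p' l"
      then obtain a where a: "a \<in> A" "c a = target s p' l" by blast
      \<comment> \<open>The catcher \<open>a\<close> takes over target \<open>l\<close>; being free,
        it keeps the assignment injective.\<close>
      have "escort k s N (Suc l) (f(l := a)) (cont c) p'"
        unfolding escort_def
      proof (intro conjI)
        show "inj_on (f(l := a)) {..<Suc l}"
          using inj a(1) by (auto simp: inj_on_def A_def free_guards_def less_Suc_eq)
        show "f(l := a) ` {..<Suc l} \<subseteq> {..<N}"
          using fN a(1) by (auto simp: A_def free_guards_def lessThan_Suc)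
        show "\<forall>\<tau><Suc l. cont c ((f(l := a)) \<tau>) = target s p' \<tau>"
          using a cont_f by (auto simp: less_Suc_eq) (simp add: cont_def)
      qed (use cont[OF c] l False in \<open>auto simp: escort_def\<close>)
      with cont[OF c] show ?thesis by blast
    next
      assume *: "(chase_measure k s A c (target s p' l), chase_measure k s A g (target s p l)) \<in> chase_order"
      \<comment> \<open>The measure sees only guards in \<open>A\<close>, where
        \<open>cont c\<close> and \<open>c\<close> agree.\<close>
      have "chase_measure k s A (cont c) (target s p' l) = chase_measure k s A c (target s p' l)"
      proof -
        have "cont c a = c a" if "a \<in> A" for a using that by (simp add: cont_def)
        then show ?thesis
          by (simp add: chase_measure_def spread_def uncovered_def total_room_def cong: conj_cong)
      qed
      with * cont[OF c] show ?thesis unfolding A_def by metis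
    qed
  qed
qed

section \<open>From well-founded progress to a winning strategy\<close>

text \<open>A strategy with internal states becomes one on histories by replaying the history.
  Outside \<open>W\<close> each round descends in \<open>R\<close>, so \<open>W\<close> is reached,
  and it is never left.\<close>

lemma bodyguards_win_if_progress:
  fixes guards :: "'s \<Rightarrow> nat \<Rightarrow> 'a" and pos :: "'s \<Rightarrow> 'a"
  assumes "wf R"
    and g0: "\<And>i. i < m \<Longrightarrow> g0 i \<in> pverts G"
    and init: "\<And>v. v \<in> pverts G \<Longrightarrow>
      \<exists>s\<in>I. pos s = v \<and> (\<forall>i<m. move_or_stay G (g0 i) (guards s i))"
    and step: "\<And>s v. s \<in> I \<Longrightarrow> move_or_stay G (pos s) v \<Longrightarrow>
      \<exists>s'\<in>I. pos s' = v \<and> (\<forall>i<m. move_or_stay G (guards s i) (guards s' i)) \<and>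
        (if s \<in> W then s' \<in> W else (s', s) \<in> R)"
    and win: "\<And>s. s \<in> I \<Longrightarrow> s \<in> W \<Longrightarrow> surrounded G (guards s ` {..<m}) (pos s)"
  shows "bodyguards_win G m"
proof -
  obtain start where start: "\<And>v. v \<in> pverts G \<Longrightarrow> start v \<in> I \<and> pos (start v) = v \<and>
      (\<forall>i<m. move_or_stay G (g0 i) (guards (start v) i))"
    using init by metis
  obtain nxt where nxt: "\<And>s v. s \<in> I \<Longrightarrow> move_or_stay G (pos s) v \<Longrightarrow>
      nxt s v \<in> I \<and> pos (nxt s v) = v \<and> (\<forall>i<m. move_or_stay G (guards s i) (guards (nxt s v) i)) \<and>
        (if s \<in> W then nxt s v \<in> W else (nxt s v, s) \<in> R)"
    using step by metis
  define \<sigma> where "\<sigma> xs = (case xs of [] \<Rightarrow> g0 | x # ys \<Rightarrow> guards (foldl nxt (start x) ys))" for xs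
  \<comment> \<open>The state after bodyguard turn \<open>t + 1\<close>, with the president still on
    \<open>p t\<close>; the first state answers \<open>p 0\<close>, hence the fold starts at index
    1.\<close>
  define st where "st p t = foldl nxt (start (p 0)) (map p [1..<Suc t])" for p t
  have at_0: "bodyguards_at \<sigma> p 0 = g0" for p
    by (simp add: bodyguards_at_def \<sigma>_def)
  have at_Suc: "bodyguards_at \<sigma> p (Suc t) = guards (st p t)" for p t
  proof -
    have "[0..<Suc t] = 0 # [1..<Suc t]" by (simp add: upt_conv_Cons del: upt_Suc)
    then show ?thesis by (simp add: bodyguards_at_def \<sigma>_def st_def del: upt_Suc)
  qed
  have st_0: "st p 0 = start (p 0)" for p by (simp add: st_def)
  have st_Suc: "st p (Suc t) = nxt (st p t) (p (Suc t))" for p t by (simp add: st_def)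
  have inv: "st p t \<in> I \<and> pos (st p t) = p t" if "president_play G p" for p t
    by (induction t) (use that start nxt in \<open>auto simp: st_0 st_Suc president_play_def\<close>)
  have nxt': "(\<forall>i<m. move_or_stay G (guards (st p t) i) (guards (st p (Suc t)) i)) \<and>
      (if st p t \<in> W then st p (Suc t) \<in> W else (st p (Suc t), st p t) \<in> R)"
    if "president_play G p" for p t
    using nxt[of "st p t" "p (Suc t)"] inv[OF that, of t] that
    by (auto simp: st_Suc president_play_def)
  have "legal_strategy G m \<sigma>"
    unfolding legal_strategy_def
  proof (intro conjI allI impI)
    show "\<sigma> [] i \<in> pverts G" if "i < m" for i using g0[OF that] by (simp add: \<sigma>_def)
    show "move_or_stay G (bodyguards_at \<sigma> p t i) (bodyguards_at \<sigma> p (Suc t) i)"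
      if "president_play G p" "i < m" for p t i
      using that nxt'[OF that(1)] start[of "p 0"]
      by (cases t) (auto simp: at_0 at_Suc st_0 president_play_def)
  qed
  moreover have "\<exists>T. \<forall>t\<ge>T. surrounded G (bodyguards_at \<sigma> p (Suc t) ` {..<m}) (p t)"
    if p: "president_play G p" for p
  proof -
    obtain T where T: "st p T \<in> W"
      using nxt'[OF p] \<open>wf R\<close> unfolding wf_iff_no_infinite_down_chain by metis
    have "st p t \<in> W" if "t \<ge> T" for t
      using that by (induction t rule: dec_induct) (use T nxt'[OF p] in \<open>auto split: if_splits\<close>)
    then show ?thesis using win inv[OF p] by (metis at_Suc)
  qed
  ultimately show ?thesis
    unfolding bodyguards_win_def winning_strategy_def by blast
qed

lemma bodyguards_win_grid:
  assumes n: "\<And>i. i \<in> {1..k} \<Longrightarrow> n i \<ge> 1"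
  shows "bodyguards_win (grid k n) (5 * k div 2)"
proof -
  define N where "N = 5 * k div 2"
  define s where "s i = n (Suc i)" for i
  define I where "I = {(l, f, g, p). escort k s N l f g p}"
  \<comment> \<open>Missing targets come first, so the chase measure may start afresh after each
    catch.\<close>
  define R where "R = inv_image (less_than <*lex*> chase_order)
    (\<lambda>(l, f, g, p). (2 * k - l, chase_measure k s (free_guards N l f) g (target s p l)))"
  define guards where "guards = (\<lambda>(l :: nat, f :: nat \<Rightarrow> nat, g :: nat \<Rightarrow> nat list, p :: nat list). g)"
  define pos where "pos = (\<lambda>(l :: nat, f :: nat \<Rightarrow> nat, g :: nat \<Rightarrow> nat list, p :: nat list). p)"
  define W where "W = {(l, f :: nat \<Rightarrow> nat, g :: nat \<Rightarrow> nat list, p :: nat list). l = 2 * k}"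
  define corner where "corner = replicate k (1 :: nat)"
  have corner: "corner \<in> box k s" using n by (auto simp: corner_def box_def s_def)
  have s_eq: "(\<lambda>i. n (Suc i)) = s" by (auto simp: s_def)
  have move: "move_or_stay (grid k n) u v \<longleftrightarrow> v \<in> box k s \<and> l1_dist k u v \<le> 1" if "u \<in> box k s" for u v
    using move_or_stay_grid[of u k n v] that by (simp add: s_eq)
  have "bodyguards_win (grid k n) N"
  proof (rule bodyguards_win_if_progress[of R N "\<lambda>_. corner" "grid k n" I pos guards W])
    show "wf R" unfolding R_def by (intro wf_inv_image wf_lex_prod wf_less_than wf_chase_order)
    show "corner \<in> pverts (grid k n)" using corner by (simp add: pverts_grid s_eq)
    \<comment> \<open>All guards start in one corner and stay there in the first turn, holding no
      target.\<close>
    show "\<exists>x\<in>I. pos x = v \<and> (\<forall>i<N. move_or_stay (grid k n) corner (guards x i))"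
      if "v \<in> pverts (grid k n)" for v
      using that corner
      by (intro bexI[of _ "(0, id, \<lambda>_. corner, v)"])
        (auto simp: I_def pos_def guards_def escort_def pverts_grid s_eq move_or_stay_def)
    show "\<exists>x'\<in>I. pos x' = v \<and> (\<forall>i<N. move_or_stay (grid k n) (guards x i) (guards x' i)) \<and>
        (if x \<in> W then x' \<in> W else (x', x) \<in> R)"
      if x: "x \<in> I" and v: "move_or_stay (grid k n) (pos x) v" for x v
    proof -
      obtain l f g p where x_eq: "x = (l, f, g, p)" by (cases x)
      have esc: "escort k s N l f g p" using x by (simp add: x_eq I_def)
      have v': "v \<in> box k s" "l1_dist k p v \<le> 1"
        using v move[of p v] esc by (auto simp: x_eq pos_def escort_def)
      have "5 * k \<le> Suc (2 * N)" unfolding N_def by linarith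
      from escort_step[OF esc this v'] obtain l' f' g' where *:
        "escort k s N l' f' g' v" "\<forall>a<N. l1_dist k (g a) (g' a) \<le> 1"
        "l = 2 * k \<and> l' = 2 * k \<or> l' = Suc l \<or>
         l' = l \<and> (chase_measure k s (free_guards N l' f') g' (target s v l'),
               chase_measure k s (free_guards N l f) g (target s p l)) \<in> chase_order" by blast
      have "\<forall>i<N. move_or_stay (grid k n) (g i) (g' i)"
        using * esc move by (auto simp: escort_def)
      \<comment> \<open>The bound \<open>l' \<le> 2 * k\<close> from \<open>escort\<close> excludes
        a further catch in \<open>W\<close> and makes \<open>2 * k - l\<close> drop strictly after a
        catch outside \<open>W\<close>.\<close>
      moreover have "if x \<in> W then (l', f', g', v) \<in> W else ((l', f', g', v), x) \<in> R"
        using * esc by (auto simp: x_eq W_def R_def escort_def)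
      ultimately show ?thesis
        using *(1) by (intro bexI[of _ "(l', f', g', v)"]) (auto simp: x_eq I_def pos_def guards_def)
    qed
    show "surrounded (grid k n) (guards x ` {..<N}) (pos x)" if xI: "x \<in> I" and xW: "x \<in> W" for x
    proof -
      obtain f g p where x_eq: "x = (2 * k, f, g, p)" using xW by (auto simp: W_def)
      have esc: "escort k s N (2 * k) f g p" using xI by (simp add: x_eq I_def)
      have "w \<in> g ` {..<N}" if w: "(p, w) \<in> parcs (grid k n)" for w
      proof -
        obtain \<tau> where \<tau>: "\<tau> < 2 * k" "w = target s p \<tau>"
          using w neighbour_is_target[of p k s w] by (auto simp: mem_parcs_grid s_eq)
        then have "w = g (f \<tau>)" "f \<tau> \<in> {..<N}" using esc by (auto simp: escort_def)
        then show ?thesis by blast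
      qed
      then show ?thesis
        by (auto simp: surrounded_def open_neighbourhood_def x_eq guards_def pos_def)
    qed
  qed
  then show ?thesis by (simp add: N_def)
qed

theorem theorem4p7:
  fixes k :: nat and n :: "nat \<Rightarrow> nat"
  assumes "k \<ge> 1" and "\<And>i. i \<in> {1..k} \<Longrightarrow> n i \<ge> 2"
  shows "int (bodyguard_number (grid k n)) \<le> \<lfloor>5 * real k / 2\<rfloor>"
proof -
  have "bodyguards_win (grid k n) (5 * k div 2)"
    using assms(2) by (intro bodyguards_win_grid) force
  then have "bodyguard_number (grid k n) \<le> 5 * k div 2"
    unfolding bodyguard_number_def by (rule Least_le)
  also have "int (5 * k div 2) = \<lfloor>5 * real k / 2\<rfloor>"
    using floor_divide_of_nat_eq[of "5 * k" 2, where ?'a = real] by simp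
  finally show ?thesis by simp
qed

end
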